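(* There are no complete weighted parabolic $L$-stable self-expanders in $\mathbb R^{n+1}$ with $|A|^2\ge\frac12$.
   Context: Hypersurfaces are smooth, connected, orientable, immersed, without boundary. For an oriented hypersurface $\Sigma\subset\mathbb R^{n+1}$ with unit normal $N$, $A$ is the second fundamental form, $|A|^2$ its squared norm, and $H$ the mean curvature (the trace of the second fundamental form, with the sign $H=\mathrm{div}_\Sigma N$); $x$ is the position vector and $\langle\cdot,\cdot\rangle$ the Euclidean metric. $\Sigma$ is a self-expander if $H=-\frac12\langle x,N\rangle$. Let $\phi_{+1}(x)=\frac{|x|^2}{4}$; self-expanders are exactly the weighted minimal hypersurfaces of $(\mathbb R^{n+1},\langle\cdot,\cdot\rangle,\phi_{+1})$, i.e. critical points of the weighted area $\int_\Sigma e^{\phi_{+1}}dv_\Sigma$ for compactly supported variations. A self-expander $\Sigma$ is $L$-stable if it is stable as a weighted minimal hypersurface, i.e. the second variation of the weighted area is nonnegative for all compactly supported variations; equivalently $$\int_\Sigma\left(|A|^2-\tfrac12\right)u^2e^{\phi_{+1}}\,dv_\Sigma\le\int_\Sigma|\nabla u|^2e^{\phi_{+1}}\,dv_\Sigma$$ for all compactly supported piecewise smooth functions $u$ on $\Sigma$. A complete self-expander $\Sigma$ with induced metric $g$ is weighted parabolic if every function $u\ge 0$ on $\Sigma$ with $\Delta u+g(\nabla\phi_{+1},\nabla u)\le 0$ is constant, where $\Delta,\nabla$ are those of $g$ and $\phi_{+1}$ is restricted to $\Sigma$. *)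

theory Defs
  imports "HOL-Analysis.Analysis"
begin

section \<open>Differentiability on open sets\<close>

(* For open S this is the usual class C^k, expressed through iterated directional derivatives. *)
fun Ck_on :: "nat \<Rightarrow> 'a::real_normed_vector set \<Rightarrow> ('a \<Rightarrow> 'b::real_normed_vector) \<Rightarrow> bool" where
  "Ck_on 0 S f \<longleftrightarrow> continuous_on S f"
| "Ck_on (Suc k) S f \<longleftrightarrow>
     (\<forall>x\<in>S. f differentiable (at x)) \<and> (\<forall>v. Ck_on k S (\<lambda>x. frechet_derivative f (at x) v))"

definition smooth_on :: "'a::real_normed_vector set \<Rightarrow> ('a \<Rightarrow> 'b::real_normed_vector) \<Rightarrow> bool" where
  "smooth_on S f \<longleftrightarrow> (\<forall>k. Ck_on k S f)"

definition partial :: "'n \<Rightarrow> (real ^ 'n \<Rightarrow> 'b::real_normed_vector) \<Rightarrow> real ^ 'n \<Rightarrow> 'b" where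
  "partial i f y = frechet_derivative f (at y) (axis i 1)"


section \<open>Smooth manifolds without boundary\<close>

(* A pair (W, \<phi>) is a local parametrization: \<phi> is the inverse of a coordinate chart,
   W is the open coordinate domain.  An atlas is a set of such pairs. *)
type_synonym ('n, 'p) parametrization = "(real ^ 'n) set \<times> (real ^ 'n \<Rightarrow> 'p)"

definition smooth_atlas :: "'p topology \<Rightarrow> ('n::finite, 'p) parametrization set \<Rightarrow> bool" where
  "smooth_atlas X \<A> \<longleftrightarrow>
     (\<forall>(W, \<phi>)\<in>\<A>. open W \<and> openin X (\<phi> ` W) \<and> embedding_map (top_of_set W) X \<phi>) \<and>
     topspace X = (\<Union>(W, \<phi>)\<in>\<A>. \<phi> ` W) \<and>
     (\<forall>(W, \<phi>)\<in>\<A>. \<forall>(W', \<phi>')\<in>\<A>. smooth_on {y\<in>W. \<phi> y \<in> \<phi>' ` W'} (inv_into W' \<phi>' \<circ> \<phi>))"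

definition smooth_manifold :: "'p topology \<Rightarrow> ('n::finite, 'p) parametrization set \<Rightarrow> bool" where
  "smooth_manifold X \<A> \<longleftrightarrow> Hausdorff_space X \<and> second_countable X \<and> smooth_atlas X \<A>"

definition Ck_fun :: "nat \<Rightarrow> ('n::finite, 'p) parametrization set \<Rightarrow> ('p \<Rightarrow> 'b::real_normed_vector) \<Rightarrow> bool" where
  "Ck_fun k \<A> u \<longleftrightarrow> (\<forall>(W, \<phi>)\<in>\<A>. Ck_on k W (u \<circ> \<phi>))"

definition smooth_fun :: "('n::finite, 'p) parametrization set \<Rightarrow> ('p \<Rightarrow> 'b::real_normed_vector) \<Rightarrow> bool" where
  "smooth_fun \<A> u \<longleftrightarrow> (\<forall>(W, \<phi>)\<in>\<A>. smooth_on W (u \<circ> \<phi>))"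


section \<open>Riemannian metrics in coordinates\<close>

(* The pullback of the Euclidean metric under f, which is a map in coordinates. *)
definition induced_metric :: "(real ^ 'n \<Rightarrow> 'e::real_inner) \<Rightarrow> real ^ 'n \<Rightarrow> real ^ 'n ^ 'n" where
  "induced_metric f y = (\<chi> i j. partial i f y \<bullet> partial j f y)"

definition christoffel ::
    "(real ^ 'n \<Rightarrow> real ^ 'n ^ 'n) \<Rightarrow> 'n::finite \<Rightarrow> 'n \<Rightarrow> 'n \<Rightarrow> real ^ 'n \<Rightarrow> real" where
  "christoffel g k i j y =
     (\<Sum>l\<in>UNIV. matrix_inv (g y) $ k $ l *
        (partial i (\<lambda>z. g z $ j $ l) y + partial j (\<lambda>z. g z $ i $ l) y
           - partial l (\<lambda>z. g z $ i $ j) y)) / 2"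

(* The metric trace of the covariant Hessian. *)
definition laplace_beltrami ::
    "(real ^ 'n \<Rightarrow> real ^ 'n ^ 'n) \<Rightarrow> (real ^ 'n \<Rightarrow> real) \<Rightarrow> real ^ 'n::finite \<Rightarrow> real" where
  "laplace_beltrami g u y =
     (\<Sum>i\<in>UNIV. \<Sum>j\<in>UNIV. matrix_inv (g y) $ i $ j *
        (partial i (partial j u) y - (\<Sum>k\<in>UNIV. christoffel g k i j y * partial k u y)))"

(* g(grad u, grad v). *)
definition grad_inner ::
    "(real ^ 'n \<Rightarrow> real ^ 'n ^ 'n) \<Rightarrow> (real ^ 'n \<Rightarrow> real) \<Rightarrow> (real ^ 'n \<Rightarrow> real) \<Rightarrow> real ^ 'n::finite \<Rightarrow> real" where
  "grad_inner g u v y =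
     (\<Sum>i\<in>UNIV. \<Sum>j\<in>UNIV. matrix_inv (g y) $ i $ j * partial i u y * partial j v y)"


section \<open>Immersed oriented hypersurfaces\<close>

(* A hypersurface is an abstract manifold (X, \<A>) with an immersion F and a global smooth unit
   normal N; for hypersurfaces of Euclidean space, such an N exists exactly when X is orientable.
   Hypersurfaces are nonempty: the empty space satisfies connected_space. *)
definition oriented_hypersurface ::
    "'p topology \<Rightarrow> ('n::finite, 'p) parametrization set \<Rightarrow> ('p \<Rightarrow> real ^ 'k) \<Rightarrow> ('p \<Rightarrow> real ^ 'k) \<Rightarrow> bool" where
  "oriented_hypersurface X \<A> F N \<longleftrightarrow>
     CARD('k) = CARD('n) + 1 \<and>
     smooth_manifold X \<A> \<and> topspace X \<noteq> {} \<and> connected_space X \<and>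
     smooth_fun \<A> F \<and> smooth_fun \<A> N \<and>
     (\<forall>(W, \<phi>)\<in>\<A>. \<forall>y\<in>W.
        inj (frechet_derivative (F \<circ> \<phi>) (at y)) \<and>
        norm (N (\<phi> y)) = 1 \<and>
        (\<forall>v. N (\<phi> y) \<bullet> frechet_derivative (F \<circ> \<phi>) (at y) v = 0))"

(* With f and \<nu> the immersion and the unit normal in coordinates, the second fundamental form is
   A(v, w) = <D_v N, w>, so that its trace is the divergence of N. *)
definition second_fundamental_form ::
    "(real ^ 'n \<Rightarrow> 'e::real_inner) \<Rightarrow> (real ^ 'n \<Rightarrow> 'e) \<Rightarrow> real ^ 'n \<Rightarrow> real ^ 'n ^ 'n" where
  "second_fundamental_form f \<nu> y = (\<chi> i j. partial i \<nu> y \<bullet> partial j f y)"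

definition mean_curvature ::
    "(real ^ 'n \<Rightarrow> 'e::real_inner) \<Rightarrow> (real ^ 'n \<Rightarrow> 'e) \<Rightarrow> real ^ 'n::finite \<Rightarrow> real" where
  "mean_curvature f \<nu> y =
     (\<Sum>i\<in>UNIV. \<Sum>j\<in>UNIV. matrix_inv (induced_metric f y) $ i $ j * second_fundamental_form f \<nu> y $ i $ j)"

definition norm_sq_A ::
    "(real ^ 'n \<Rightarrow> 'e::real_inner) \<Rightarrow> (real ^ 'n \<Rightarrow> 'e) \<Rightarrow> real ^ 'n::finite \<Rightarrow> real" where
  "norm_sq_A f \<nu> y =
     (let G = matrix_inv (induced_metric f y); h = second_fundamental_form f \<nu> y in
      \<Sum>i\<in>UNIV. \<Sum>j\<in>UNIV. \<Sum>k\<in>UNIV. \<Sum>l\<in>UNIV. G $ i $ k * G $ j $ l * h $ i $ j * h $ k $ l)"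

definition self_expander ::
    "'p topology \<Rightarrow> ('n::finite, 'p) parametrization set \<Rightarrow> ('p \<Rightarrow> real ^ 'k) \<Rightarrow> ('p \<Rightarrow> real ^ 'k) \<Rightarrow> bool" where
  "self_expander X \<A> F N \<longleftrightarrow>
     oriented_hypersurface X \<A> F N \<and>
     (\<forall>(W, \<phi>)\<in>\<A>. \<forall>y\<in>W. mean_curvature (F \<circ> \<phi>) (N \<circ> \<phi>) y = - (1 / 2) * (F (\<phi> y) \<bullet> N (\<phi> y)))"


section \<open>Completeness\<close>

definition piecewise_C1_curve ::
    "'p topology \<Rightarrow> ('n::finite, 'p) parametrization set \<Rightarrow> (real \<Rightarrow> 'p) \<Rightarrow> bool" where
  "piecewise_C1_curve X \<A> \<gamma> \<longleftrightarrow>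
     pathin X \<gamma> \<and>
     (\<exists>S. finite S \<and>
        (\<forall>(W, \<phi>)\<in>\<A>. (inv_into W \<phi> \<circ> \<gamma>) C1_differentiable_on {t\<in>{0..1} - S. \<gamma> t \<in> \<phi> ` W}))"

(* The length for the metric induced by F, which is the Euclidean length of the image curve.  It may
   be infinite, because derivatives may blow up at the break points. *)
definition curve_length :: "('p \<Rightarrow> real ^ 'k) \<Rightarrow> (real \<Rightarrow> 'p) \<Rightarrow> ennreal" where
  "curve_length F \<gamma> = (\<integral>\<^sup>+t\<in>{0..1}. ennreal (norm (vector_derivative (F \<circ> \<gamma>) (at t))) \<partial>lborel)"

definition induced_dist ::
    "'p topology \<Rightarrow> ('n::finite, 'p) parametrization set \<Rightarrow> ('p \<Rightarrow> real ^ 'k) \<Rightarrow> 'p \<Rightarrow> 'p \<Rightarrow> real" where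
  "induced_dist X \<A> F p q =
     enn2real (INF \<gamma>\<in>{\<gamma>. piecewise_C1_curve X \<A> \<gamma> \<and> \<gamma> 0 = p \<and> \<gamma> 1 = q}. curve_length F \<gamma>)"

definition complete_hypersurface ::
    "'p topology \<Rightarrow> ('n::finite, 'p) parametrization set \<Rightarrow> ('p \<Rightarrow> real ^ 'k) \<Rightarrow> bool" where
  "complete_hypersurface X \<A> F \<longleftrightarrow> Metric_space.mcomplete (topspace X) (induced_dist X \<A> F)"


section \<open>Weighted area and stability\<close>

definition expander_weight :: "'e::real_normed_vector \<Rightarrow> real" where
  "expander_weight x = (norm x)\<^sup>2 / 4"

definition borel_sets_of :: "'p topology \<Rightarrow> 'p set set" where
  "borel_sets_of X = sigma_sets (topspace X) {U. openin X U}"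

(* The volume measure of the pullback metric under G: the Borel measure with density
   sqrt (det g) in every parametrization.  It exists, and it is unique because countably many
   coordinate patches cover X. *)
definition volume_measure ::
    "'p topology \<Rightarrow> ('n::finite, 'p) parametrization set \<Rightarrow> ('p \<Rightarrow> real ^ 'k) \<Rightarrow> 'p measure" where
  "volume_measure X \<A> G =
     (THE \<mu>. space \<mu> = topspace X \<and> sets \<mu> = borel_sets_of X \<and>
        (\<forall>(W, \<phi>)\<in>\<A>. \<forall>B\<in>borel_sets_of X. B \<subseteq> \<phi> ` W \<longrightarrow>
           emeasure \<mu> B =
             (\<integral>\<^sup>+y\<in>{y\<in>W. \<phi> y \<in> B}. ennreal (sqrt (det (induced_metric (G \<circ> \<phi>) y))) \<partial>lborel)))"

definition weighted_area ::
    "'p topology \<Rightarrow> ('n::finite, 'p) parametrization set \<Rightarrow> 'p set \<Rightarrow> ('p \<Rightarrow> real ^ 'k) \<Rightarrow> real" where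
  "weighted_area X \<A> K G =
     set_lebesgue_integral (volume_measure X \<A> G) K (\<lambda>p. exp (expander_weight (G p)))"

(* A smooth variation of F for times |t| < e, supported in the compact set K.  Near t = 0 it
   consists of immersions, by compactness of K. *)
definition compact_variation ::
    "'p topology \<Rightarrow> ('n::finite, 'p) parametrization set \<Rightarrow> ('p \<Rightarrow> real ^ 'k) \<Rightarrow> 'p set \<Rightarrow> real \<Rightarrow>
       (real \<Rightarrow> 'p \<Rightarrow> real ^ 'k) \<Rightarrow> bool" where
  "compact_variation X \<A> F K e \<Phi> \<longleftrightarrow>
     compactin X K \<and> 0 < e \<and>
     (\<forall>(W, \<phi>)\<in>\<A>. smooth_on ({-e<..<e} \<times> W) (\<lambda>(t, y). \<Phi> t (\<phi> y))) \<and>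
     (\<forall>p\<in>topspace X. \<Phi> 0 p = F p) \<and>
     (\<forall>t\<in>{-e<..<e}. \<forall>p\<in>topspace X - K. \<Phi> t p = F p)"

(* The area of X may be infinite, so the second variation is that of the area of K, which
   contains the support of the variation. *)
definition L_stable ::
    "'p topology \<Rightarrow> ('n::finite, 'p) parametrization set \<Rightarrow> ('p \<Rightarrow> real ^ 'k) \<Rightarrow> bool" where
  "L_stable X \<A> F \<longleftrightarrow>
     (\<forall>K e \<Phi>. compact_variation X \<A> F K e \<Phi> \<longrightarrow>
        deriv (deriv (\<lambda>t. weighted_area X \<A> K (\<Phi> t))) 0 \<ge> 0)"


section \<open>Weighted parabolicity\<close>

definition weighted_parabolic ::
    "'p topology \<Rightarrow> ('n::finite, 'p) parametrization set \<Rightarrow> ('p \<Rightarrow> real ^ 'k) \<Rightarrow> bool" where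
  "weighted_parabolic X \<A> F \<longleftrightarrow>
     (\<forall>u :: 'p \<Rightarrow> real.
        Ck_fun 2 \<A> u \<and> (\<forall>p\<in>topspace X. u p \<ge> 0) \<and>
        (\<forall>(W, \<phi>)\<in>\<A>. \<forall>y\<in>W.
           laplace_beltrami (induced_metric (F \<circ> \<phi>)) (u \<circ> \<phi>) y
           + grad_inner (induced_metric (F \<circ> \<phi>)) (expander_weight \<circ> F \<circ> \<phi>) (u \<circ> \<phi>) y \<le> 0)
        \<longrightarrow> u constant_on topspace X)"

end

theory Submission
  imports Defs
begin

text \<open>
  Write \<open>f\<close> for the position vector, \<open>\<phi>\<close> for the weight \<open>|f|\<^sup>2 / 4\<close> and
  \<open>L v = \<Delta> v + \<langle>\<nabla>\<phi>, \<nabla>v\<rangle>\<close>. Since \<open>\<Delta> f = - H N = \<langle>f, N\<rangle> N / 2\<close>, one finds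
  \<open>L \<phi> = n / 2 + \<langle>f, N\<rangle>\<^sup>2 / 4 + |\<nabla>\<phi>|\<^sup>2\<close>. As \<open>L exp (- \<phi>) = exp (- \<phi>) (|\<nabla>\<phi>|\<^sup>2 - L \<phi>)\<close>, the positive function
  \<open>exp (- \<phi>)\<close> satisfies \<open>L exp (- \<phi>) = - exp (- \<phi>) (n / 2 + \<langle>f, N\<rangle>\<^sup>2 / 4) < 0\<close>. Weighted parabolicity
  would make it constant, which is absurd. So no self-expander at all is weighted parabolic.
\<close>

section \<open>Second derivatives\<close>

lemma Ck_on_2_D:
  assumes "Ck_on 2 S f" "x \<in> S"
  shows "(f has_derivative frechet_derivative f (at x)) (at x)"
    and "((\<lambda>x. frechet_derivative f (at x) v) has_derivative
          frechet_derivative (\<lambda>x. frechet_derivative f (at x) v) (at x)) (at x)"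
    and "continuous_on S (\<lambda>x. frechet_derivative (\<lambda>x. frechet_derivative f (at x) v) (at x) w)"
  using assms by (auto simp: numeral_2_eq_2 frechet_derivative_works[symmetric])

text \<open>Explicit candidates \<open>D1\<close> and \<open>D2\<close> are differentiated by the
  usual rules; the values of \<open>frechet_derivative\<close> and membership in the class C^2 then
  follow together from uniqueness of derivatives.\<close>

lemma Ck_on_2_I:
  fixes f :: "'a::real_normed_vector \<Rightarrow> 'b::real_normed_vector"
  assumes S: "open S"
    and D1: "\<And>x. x \<in> S \<Longrightarrow> (f has_derivative (\<lambda>v. D1 v x)) (at x)"
    and D2: "\<And>x v. x \<in> S \<Longrightarrow> (D1 v has_derivative (\<lambda>w. D2 v w x)) (at x)"
    and cont: "\<And>v w. continuous_on S (D2 v w)"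
  shows "Ck_on 2 S f"
    and "\<And>x v. x \<in> S \<Longrightarrow> frechet_derivative f (at x) v = D1 v x"
    and "\<And>x v w. x \<in> S \<Longrightarrow>
           frechet_derivative (\<lambda>x. frechet_derivative f (at x) v) (at x) w = D2 v w x"
proof -
  show 1: "frechet_derivative f (at x) v = D1 v x" if "x \<in> S" for x v
    using frechet_derivative_at[OF D1[OF that]] by metis
  have 2: "((\<lambda>x. frechet_derivative f (at x) v) has_derivative (\<lambda>w. D2 v w x)) (at x)"
    if "x \<in> S" for x v
    \<comment> \<open>The first derivative agrees with \<open>D1 v\<close> only on \<open>S\<close>;
      openness of \<open>S\<close> makes that enough for differentiating once more.\<close>
    by (rule has_derivative_transform_within_open[OF D2[OF that] S that]) (simp add: 1)
  show 3: "frechet_derivative (\<lambda>x. frechet_derivative f (at x) v) (at x) w = D2 v w x"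
    if "x \<in> S" for x v w
    using frechet_derivative_at[OF 2[OF that]] by metis
  have "continuous_on S (\<lambda>x. frechet_derivative (\<lambda>x. frechet_derivative f (at x) v) (at x) w)" for v w
    using cont[of v w] by (rule continuous_on_eq) (simp add: 3)
  moreover have "f differentiable (at x)" "(\<lambda>x. frechet_derivative f (at x) v) differentiable (at x)"
    if "x \<in> S" for x v
    using D1[OF that] 2[OF that] by (auto intro: differentiableI)
  ultimately show "Ck_on 2 S f"
    by (simp add: numeral_2_eq_2)
qed

text \<open>The mean value theorem is applied twice: along \<open>v\<close> to the increment in
  direction \<open>w\<close>, then along \<open>w\<close> to the derivative in direction
  \<open>v\<close>. The second difference is symmetric in \<open>v\<close> and \<open>w\<close>,
  which is what the symmetry of second derivatives rests on.\<close>

lemma second_difference_mean_value: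
  fixes h :: "'a::real_normed_vector \<Rightarrow> real"
  assumes h: "Ck_on 2 S h" and "0 < \<epsilon>"
    and sub: "\<And>s t. \<lbrakk>0 \<le> s; s \<le> \<epsilon>; 0 \<le> t; t \<le> \<epsilon>\<rbrakk> \<Longrightarrow> y + s *\<^sub>R v + t *\<^sub>R w \<in> S"
  obtains s t where "0 \<le> s" "s \<le> \<epsilon>" "0 \<le> t" "t \<le> \<epsilon>"
    "h (y + \<epsilon> *\<^sub>R v + \<epsilon> *\<^sub>R w) - h (y + \<epsilon> *\<^sub>R v) - h (y + \<epsilon> *\<^sub>R w) + h y =
     \<epsilon> * (\<epsilon> * frechet_derivative (\<lambda>x. frechet_derivative h (at x) v) (at (y + s *\<^sub>R v + t *\<^sub>R w)) w)"
proof -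
  let ?D = "\<lambda>x. frechet_derivative h (at x)"
  let ?D2 = "\<lambda>x. frechet_derivative (\<lambda>x. ?D x v) (at x) w"
  have d1: "((\<lambda>s. h (y + s *\<^sub>R v + t *\<^sub>R w)) has_real_derivative ?D (y + s *\<^sub>R v + t *\<^sub>R w) v) (at s)"
    if "0 \<le> s" "s \<le> \<epsilon>" "0 \<le> t" "t \<le> \<epsilon>" for s t
  proof -
    note D = Ck_on_2_D(1)[OF h sub[OF that]]
    have "((\<lambda>s. h (y + s *\<^sub>R v + t *\<^sub>R w)) has_derivative (\<lambda>r. ?D (y + s *\<^sub>R v + t *\<^sub>R w) (r *\<^sub>R v))) (at s)"
      by (rule has_derivative_compose[where f = "\<lambda>s. y + s *\<^sub>R v + t *\<^sub>R w" and g = h, OF _ D])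
        (auto intro!: derivative_eq_intros)
    then show ?thesis
      by (rule has_derivative_imp_has_field_derivative) (simp add: linear_cmul[OF has_derivative_linear[OF D]])
  qed
  have d2: "((\<lambda>t. ?D (y + s *\<^sub>R v + t *\<^sub>R w) v) has_real_derivative ?D2 (y + s *\<^sub>R v + t *\<^sub>R w)) (at t)"
    if "0 \<le> s" "s \<le> \<epsilon>" "0 \<le> t" "t \<le> \<epsilon>" for s t
  proof -
    note D = Ck_on_2_D(2)[OF h sub[OF that], of v]
    have "((\<lambda>t. ?D (y + s *\<^sub>R v + t *\<^sub>R w) v) has_derivative
        (\<lambda>r. frechet_derivative (\<lambda>x. ?D x v) (at (y + s *\<^sub>R v + t *\<^sub>R w)) (r *\<^sub>R w))) (at t)"
      by (rule has_derivative_compose[where f = "\<lambda>t. y + s *\<^sub>R v + t *\<^sub>R w"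
            and g = "\<lambda>x. ?D x v", OF _ D])
        (auto intro!: derivative_eq_intros)
    then show ?thesis
      by (rule has_derivative_imp_has_field_derivative) (simp add: linear_cmul[OF has_derivative_linear[OF D]])
  qed
  \<comment> \<open>The term \<open>0 *\<^sub>R w\<close> is kept so that \<open>d1\<close> covers
    both summands, with \<open>t = \<epsilon>\<close> and with \<open>t = 0\<close>.\<close>
  let ?k = "\<lambda>s. h (y + s *\<^sub>R v + \<epsilon> *\<^sub>R w) - h (y + s *\<^sub>R v + 0 *\<^sub>R w)"
  have "\<exists>s>0. s < \<epsilon> \<and> ?k \<epsilon> - ?k 0 =
      (\<epsilon> - 0) * (?D (y + s *\<^sub>R v + \<epsilon> *\<^sub>R w) v - ?D (y + s *\<^sub>R v + 0 *\<^sub>R w) v)"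
    using \<open>0 < \<epsilon>\<close> by (intro MVT2 DERIV_diff d1) auto
  then obtain s where s: "0 < s" "s < \<epsilon>" "?k \<epsilon> - ?k 0 =
      \<epsilon> * (?D (y + s *\<^sub>R v + \<epsilon> *\<^sub>R w) v - ?D (y + s *\<^sub>R v + 0 *\<^sub>R w) v)" by auto
  have "\<exists>t>0. t < \<epsilon> \<and> ?D (y + s *\<^sub>R v + \<epsilon> *\<^sub>R w) v - ?D (y + s *\<^sub>R v + 0 *\<^sub>R w) v =
      (\<epsilon> - 0) * ?D2 (y + s *\<^sub>R v + t *\<^sub>R w)"
    using \<open>0 < \<epsilon>\<close> s by (intro MVT2 d2) auto
  then obtain t where t: "0 < t" "t < \<epsilon>" "?D (y + s *\<^sub>R v + \<epsilon> *\<^sub>R w) v - ?D (y + s *\<^sub>R v + 0 *\<^sub>R w) v =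
      \<epsilon> * ?D2 (y + s *\<^sub>R v + t *\<^sub>R w)" by auto
  show thesis
    by (rule that[of s t]) (use s t in auto)
qed

text \<open>Schwarz's theorem. Both mixed derivatives, taken at suitable points near
  \<open>y\<close>, equal the same second difference divided by \<open>\<epsilon>\<close> squared;
  by continuity their values at \<open>y\<close> cannot differ.\<close>

lemma frechet_derivative_symmetric_real:
  fixes h :: "'a::real_normed_vector \<Rightarrow> real"
  assumes h: "Ck_on 2 S h" and S: "open S" "y \<in> S"
  shows "frechet_derivative (\<lambda>x. frechet_derivative h (at x) v) (at y) w =
         frechet_derivative (\<lambda>x. frechet_derivative h (at x) w) (at y) v"
proof (rule ccontr)
  let ?D2 = "\<lambda>v w x. frechet_derivative (\<lambda>x. frechet_derivative h (at x) v) (at x) w"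
  assume ne: "?D2 v w y \<noteq> ?D2 w v y"
  \<comment> \<open>Half the gap: no number lies within \<open>e\<close> of both values.\<close>
  define e where "e = \<bar>?D2 v w y - ?D2 w v y\<bar> / 2"
  have "e > 0" using ne by (simp add: e_def)
  have lim: "\<forall>\<^sub>F x in nhds y. \<bar>?D2 a b x - ?D2 a b y\<bar> < e" for a b
  proof -
    have "isCont (?D2 a b) y"
      using Ck_on_2_D(3)[OF h S(2)] S by (simp add: continuous_on_eq_continuous_at)
    then have "(?D2 a b \<longlongrightarrow> ?D2 a b y) (nhds y)"
      by (simp add: isCont_def tendsto_at_iff_tendsto_nhds[of "?D2 a b" y])
    then show ?thesis
      using \<open>e > 0\<close> by (auto dest!: tendstoD simp: dist_real_def)
  qed
  have "\<forall>\<^sub>F x in nhds y. x \<in> S \<and> \<bar>?D2 v w x - ?D2 v w y\<bar> < e \<and> \<bar>?D2 w v x - ?D2 w v y\<bar> < e"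
    using eventually_conj[OF eventually_nhds_in_open[OF S] eventually_conj[OF lim[of v w] lim[of w v]]]
    by simp
  then obtain d where "d > 0" and
    d: "\<And>x. dist x y < d \<Longrightarrow> x \<in> S \<and> \<bar>?D2 v w x - ?D2 v w y\<bar> < e \<and> \<bar>?D2 w v x - ?D2 w v y\<bar> < e"
    unfolding eventually_nhds_metric by blast
  \<comment> \<open>The summand 1 keeps \<open>m\<close> positive when \<open>v\<close> and
    \<open>w\<close> vanish. The choice of \<open>\<epsilon>\<close> gives
    \<open>\<epsilon> * (norm v + norm w) < d\<close>, so the whole parallelogram lies in the ball
    of radius \<open>d\<close>.\<close>
  define m where "m = norm v + norm w + 1"
  define \<epsilon> where "\<epsilon> = d / (2 * m)"
  have n: "m > 0" by (simp add: m_def add_nonneg_pos)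
  then have "\<epsilon> > 0" using \<open>d > 0\<close> by (simp add: \<epsilon>_def)
  have near: "dist (y + s *\<^sub>R v + t *\<^sub>R w) y < d" if "0 \<le> s" "s \<le> \<epsilon>" "0 \<le> t" "t \<le> \<epsilon>" for s t
  proof -
    have "dist (y + s *\<^sub>R v + t *\<^sub>R w) y = norm (s *\<^sub>R v + t *\<^sub>R w)"
      by (simp add: dist_norm)
    also have "\<dots> \<le> s * norm v + t * norm w"
      using norm_triangle_ineq[of "s *\<^sub>R v" "t *\<^sub>R w"] that by simp
    also have "\<dots> \<le> \<epsilon> * norm v + \<epsilon> * norm w"
      using that by (intro add_mono mult_right_mono) auto
    also have "\<dots> < \<epsilon> * (2 * m)"
      using \<open>\<epsilon> > 0\<close> by (simp add: m_def algebra_simps add_nonneg_pos)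
    also have "\<dots> = d"
      using n by (simp add: \<epsilon>_def)
    finally show ?thesis .
  qed
  have near': "dist (y + s *\<^sub>R w + t *\<^sub>R v) y < d" if "0 \<le> s" "s \<le> \<epsilon>" "0 \<le> t" "t \<le> \<epsilon>" for s t
    using near[of t s] that by (simp add: add.commute add.left_commute)
  obtain s t where 1: "0 \<le> s" "s \<le> \<epsilon>" "0 \<le> t" "t \<le> \<epsilon>"
    "h (y + \<epsilon> *\<^sub>R v + \<epsilon> *\<^sub>R w) - h (y + \<epsilon> *\<^sub>R v) - h (y + \<epsilon> *\<^sub>R w) + h y =
     \<epsilon> * (\<epsilon> * ?D2 v w (y + s *\<^sub>R v + t *\<^sub>R w))"
    using second_difference_mean_value[OF h \<open>\<epsilon> > 0\<close>] near d by blast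
  obtain s' t' where 2: "0 \<le> s'" "s' \<le> \<epsilon>" "0 \<le> t'" "t' \<le> \<epsilon>"
    "h (y + \<epsilon> *\<^sub>R w + \<epsilon> *\<^sub>R v) - h (y + \<epsilon> *\<^sub>R w) - h (y + \<epsilon> *\<^sub>R v) + h y =
     \<epsilon> * (\<epsilon> * ?D2 w v (y + s' *\<^sub>R w + t' *\<^sub>R v))"
    using second_difference_mean_value[OF h \<open>\<epsilon> > 0\<close>] near' d by blast
  have "\<epsilon> * (\<epsilon> * ?D2 v w (y + s *\<^sub>R v + t *\<^sub>R w)) = \<epsilon> * (\<epsilon> * ?D2 w v (y + s' *\<^sub>R w + t' *\<^sub>R v))"
    using 1(5) 2(5) by (simp add: algebra_simps)
  then have "?D2 v w (y + s *\<^sub>R v + t *\<^sub>R w) = ?D2 w v (y + s' *\<^sub>R w + t' *\<^sub>R v)"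
    using \<open>\<epsilon> > 0\<close> by simp
  then show False
    using d[OF near[OF 1(1-4)]] d[OF near'[OF 2(1-4)]] unfolding e_def by (simp add: abs_if split: if_splits)
qed

text \<open>Pairing with an arbitrary vector \<open>c\<close> reduces the claim to real-valued
  functions, and these pairings determine a vector.\<close>

lemma frechet_derivative_symmetric:
  fixes f :: "'a::real_normed_vector \<Rightarrow> 'b::real_inner"
  assumes f: "Ck_on 2 S f" and S: "open S" "y \<in> S"
  shows "frechet_derivative (\<lambda>x. frechet_derivative f (at x) v) (at y) w =
         frechet_derivative (\<lambda>x. frechet_derivative f (at x) w) (at y) v"
proof -
  let ?D = "\<lambda>v x. frechet_derivative f (at x) v"
  let ?D2 = "\<lambda>v w x. frechet_derivative (?D v) (at x) w"
  have "?D2 v w y \<bullet> c = ?D2 w v y \<bullet> c" for c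
  proof -
    have 1: "((\<lambda>x. f x \<bullet> c) has_derivative (\<lambda>v. ?D v x \<bullet> c)) (at x)" if "x \<in> S" for x
      by (intro has_derivative_inner_left Ck_on_2_D(1)[OF f that])
    have 2: "((\<lambda>x. ?D v x \<bullet> c) has_derivative (\<lambda>w. ?D2 v w x \<bullet> c)) (at x)" if "x \<in> S" for x v
      by (intro has_derivative_inner_left Ck_on_2_D(2)[OF f that])
    have 3: "continuous_on S (\<lambda>x. ?D2 v w x \<bullet> c)" for v w
      by (intro continuous_intros Ck_on_2_D(3)[OF f S(2)])
    note C = Ck_on_2_I[OF S(1) 1 2 3]
    show ?thesis
      using frechet_derivative_symmetric_real[OF C(1) S, of v w] by (simp add: C(3) S)
  qed
  then show ?thesis
    by (metis vector_eq_ldot inner_commute)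
qed


lemma partial_eqI: "(f has_derivative D) (at y) \<Longrightarrow> partial i f y = D (axis i 1)"
  by (simp add: partial_def flip: frechet_derivative_at)


section \<open>Linear algebra at a point\<close>

lemma matrix_inv_works:
  fixes A :: "real ^ 'n ^ 'n"
  assumes "invertible A"
  shows "A ** matrix_inv A = mat 1" and "matrix_inv A ** A = mat 1"
  using someI_ex[OF assms[unfolded invertible_def]] by (auto simp: matrix_inv_def)

text \<open>The induced metric is the Gram matrix of the partial derivatives. If it kills
  \<open>v\<close>, then \<open>?D v\<close> is orthogonal to every partial derivative, hence to
  itself, and injectivity gives \<open>v = 0\<close>.\<close>

lemma invertible_induced_metric:
  fixes f :: "real ^ 'n \<Rightarrow> 'e::real_inner"
  assumes "linear (frechet_derivative f (at y))" "inj (frechet_derivative f (at y))"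
  shows "invertible (induced_metric f y)"
proof -
  let ?D = "frechet_derivative f (at y)"
  have D: "?D v = (\<Sum>i\<in>UNIV. v $ i *\<^sub>R partial i f y)" for v
  proof -
    have "?D v = ?D (\<Sum>i\<in>UNIV. v $ i *\<^sub>R axis i 1)"
      using basis_expansion[of v] by (simp add: scalar_mult_eq_scaleR)
    also have "\<dots> = (\<Sum>i\<in>UNIV. v $ i *\<^sub>R partial i f y)"
      by (simp add: linear_sum[OF assms(1)] linear_cmul[OF assms(1)] partial_def)
    finally show ?thesis .
  qed
  have "v = 0" if "induced_metric f y *v v = 0" for v
  proof -
    have "(induced_metric f y *v v) $ i = partial i f y \<bullet> ?D v" for i
      unfolding D by (simp add: matrix_vector_mult_def induced_metric_def inner_sum_right mult.commute)
    then have "partial i f y \<bullet> ?D v = 0" for i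
      using that by simp
    then have "?D v \<bullet> ?D v = 0"
      unfolding D by (simp add: inner_sum_left)
    then show ?thesis
      using assms(2) linear_0[OF assms(1)] by (metis inner_eq_zero_iff injD)
  qed
  then show ?thesis
    by (simp add: invertible_left_inverse matrix_left_invertible_ker)
qed

text \<open>This is where codimension one enters: \<open>range D\<close> and \<open>\<nu>\<close>
  together span the space by a dimension count. The difference of the two sides is orthogonal to
  both, hence to itself.\<close>

lemma normal_component:
  fixes D :: "real ^ 'n \<Rightarrow> 'e::euclidean_space"
  assumes D: "linear D" "inj D" and dim: "DIM('e) = CARD('n) + 1"
    and \<nu>: "norm \<nu> = 1" "\<And>v. \<nu> \<bullet> D v = 0"
    and w: "\<And>i. w \<bullet> D (axis i 1) = 0"
  shows "w = (w \<bullet> \<nu>) *\<^sub>R \<nu>"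
proof -
  have wD: "w \<bullet> D v = 0" for v
  proof -
    have "D v = D (\<Sum>i\<in>UNIV. v $ i *\<^sub>R axis i 1)"
      using basis_expansion[of v] by (simp add: scalar_mult_eq_scaleR)
    also have "w \<bullet> \<dots> = 0"
      by (simp add: linear_sum[OF D(1)] linear_cmul[OF D(1)] inner_sum_right w)
    finally show ?thesis .
  qed
  have \<nu>\<nu>: "\<nu> \<bullet> \<nu> = 1" using \<nu>(1) by (simp add: dot_square_norm)
  have "span (range D) = range D"
    using linear_subspace_image[OF D(1) subspace_UNIV] by (simp only: span_eq_iff)
  moreover have "\<nu> \<notin> range D"
    using \<nu>(2) \<nu>\<nu> by force
  ultimately have "\<nu> \<notin> span (range D)" by (simp only: not_False_eq_True)
  moreover have "dim (range D) = CARD('n)"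
    using dim_image_eq[of D UNIV] D by simp
  ultimately have "dim (insert \<nu> (range D)) = DIM('e)"
    by (simp add: dim_insert dim)
  then have full: "span (insert \<nu> (range D)) = UNIV"
    by (simp add: dim_eq_full)
  define u where "u = w - (w \<bullet> \<nu>) *\<^sub>R \<nu>"
  have "orthogonal u x" if "x \<in> insert \<nu> (range D)" for x
    using that wD \<nu>(2) \<nu>\<nu> by (auto simp: orthogonal_def u_def inner_diff_left)
  then have "orthogonal u u"
    using orthogonal_to_span[of u "insert \<nu> (range D)" u] full by auto
  then show ?thesis
    by (simp add: orthogonal_def u_def)
qed


section \<open>The Gaussian of the position vector\<close>

lemma
  fixes f :: "'a::real_normed_vector \<Rightarrow> 'e::real_inner"
  assumes f: "Ck_on 2 S f" and S: "open S"
  defines "u \<equiv> \<lambda>x. exp (- expander_weight (f x))"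
  shows Ck_on_2_gaussian: "Ck_on 2 S u"
    and frechet_derivative_gaussian: "\<And>x v. x \<in> S \<Longrightarrow>
      frechet_derivative u (at x) v = - 1 / 2 * (u x * (f x \<bullet> frechet_derivative f (at x) v))"
    and frechet_derivative_gaussian2: "\<And>x v w. x \<in> S \<Longrightarrow>
      frechet_derivative (\<lambda>x. frechet_derivative u (at x) v) (at x) w =
        u x * ((f x \<bullet> frechet_derivative f (at x) v) * (f x \<bullet> frechet_derivative f (at x) w) / 4
          - (frechet_derivative f (at x) w \<bullet> frechet_derivative f (at x) v
             + f x \<bullet> frechet_derivative (\<lambda>x. frechet_derivative f (at x) v) (at x) w) / 2)"
proof -
  let ?D = "\<lambda>v x. frechet_derivative f (at x) v"
  let ?D2 = "\<lambda>v w x. frechet_derivative (?D v) (at x) w"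
  \<comment> \<open>The squared norm is rewritten as an inner product so that the product rule for
    inner products applies.\<close>
  have u: "u = (\<lambda>x. exp (- 1 / 4 * (f x \<bullet> f x)))"
    by (simp add: u_def expander_weight_def power2_norm_eq_inner)
  have 1: "(u has_derivative (\<lambda>v. - 1 / 2 * (u x * (f x \<bullet> ?D v x)))) (at x)" if "x \<in> S" for x
    unfolding u
    by (rule has_derivative_eq_rhs[OF has_derivative_exp[OF has_derivative_mult_right[OF
            has_derivative_inner[OF Ck_on_2_D(1,1)[OF f that]]]]])
       (simp add: inner_commute fun_eq_iff)
  have 2: "((\<lambda>x. - 1 / 2 * (u x * (f x \<bullet> ?D v x))) has_derivative
      (\<lambda>w. u x * ((f x \<bullet> ?D v x) * (f x \<bullet> ?D w x) / 4 - (?D w x \<bullet> ?D v x + f x \<bullet> ?D2 v w x) / 2))) (at x)"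
    if "x \<in> S" for x v
    by (rule has_derivative_eq_rhs[OF has_derivative_mult_right[OF has_derivative_mult[OF
            1[OF that] has_derivative_inner[OF Ck_on_2_D(1,2)[OF f that]]]]])
       (simp add: fun_eq_iff field_simps)
  have "continuous_on S (?D v)" "continuous_on S f" for v
    using Ck_on_2_D(1,2)[OF f] S
    by (meson continuous_at_imp_continuous_on has_derivative_continuous)+
  moreover from this have "continuous_on S u"
    unfolding u by (intro continuous_intros) auto
  ultimately have 3: "continuous_on S (\<lambda>x. u x * ((f x \<bullet> ?D v x) * (f x \<bullet> ?D w x) / 4
      - (?D w x \<bullet> ?D v x + f x \<bullet> ?D2 v w x) / 2))" for v w
    \<comment> \<open>The continuity part of \<open>Ck_on_2_D\<close> carries the premise that
      \<open>S\<close> has a point, so the empty set is treated separately.\<close>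
    by (cases "S = {}") (auto intro!: continuous_intros Ck_on_2_D(3)[OF f])
  show "Ck_on 2 S u"
    by (rule Ck_on_2_I(1)[OF S 1 2 3])
  show "frechet_derivative u (at x) v = - 1 / 2 * (u x * (f x \<bullet> ?D v x))" if "x \<in> S" for x v
    by (rule Ck_on_2_I(2)[OF S 1 2 3 that])
  show "frechet_derivative (\<lambda>x. frechet_derivative u (at x) v) (at x) w =
      u x * ((f x \<bullet> ?D v x) * (f x \<bullet> ?D w x) / 4 - (?D w x \<bullet> ?D v x + f x \<bullet> ?D2 v w x) / 2)"
    if "x \<in> S" for x v w
    by (rule Ck_on_2_I(3)[OF S 1 2 3 that])
qed

section \<open>The drift Laplacian of the Gaussian in coordinates\<close>

lemma
  fixes f :: "real ^ 'n \<Rightarrow> 'e::real_inner"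
  assumes f: "Ck_on 2 S f" and S: "open S" "y \<in> S"
  shows partial_induced_metric:
      "partial i (\<lambda>z. induced_metric f z $ j $ l) y =
        partial i (partial j f) y \<bullet> partial l f y + partial j f y \<bullet> partial i (partial l f) y"
    and partial_symmetric: "partial i (partial j f) y = partial j (partial i f) y"
    and partial_expander_weight: "partial i (expander_weight \<circ> f) y = (f y \<bullet> partial i f y) / 2"
proof -
  have d: "(partial j f has_derivative frechet_derivative (partial j f) (at y)) (at y)" for j
    using Ck_on_2_D(2)[OF f S(2)] by (simp add: partial_def[abs_def])
  have "((\<lambda>z. induced_metric f z $ j $ l) has_derivative
      (\<lambda>v. partial j f y \<bullet> frechet_derivative (partial l f) (at y) v
         + frechet_derivative (partial j f) (at y) v \<bullet> partial l f y)) (at y)"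
    by (simp add: induced_metric_def) (intro has_derivative_inner d)
  from partial_eqI[OF this] show "partial i (\<lambda>z. induced_metric f z $ j $ l) y =
        partial i (partial j f) y \<bullet> partial l f y + partial j f y \<bullet> partial i (partial l f) y"
    by (simp add: partial_def[of i] add.commute)
  show "partial i (partial j f) y = partial j (partial i f) y"
    using frechet_derivative_symmetric[OF f S] by (simp add: partial_def[abs_def])
  have "((expander_weight \<circ> f) has_derivative (\<lambda>v. (f y \<bullet> frechet_derivative f (at y) v) / 2)) (at y)"
    unfolding comp_def expander_weight_def power2_norm_eq_inner
    by (auto intro!: derivative_eq_intros Ck_on_2_D(1)[OF f S(2)] simp: inner_commute)
  from partial_eqI[OF this] show "partial i (expander_weight \<circ> f) y = (f y \<bullet> partial i f y) / 2"
    by (simp add: partial_def)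
qed

text \<open>The covariant Hessian of the position vector is normal, equal to
  \<open>- h i j *\<^sub>R \<nu> y\<close>. After taking the trace, the squared gradient terms of
  the Laplacian cancel against the drift; the trace of the metric contributes the dimension, and the
  mean curvature contributes the square of \<open>f y \<bullet> \<nu> y\<close>.\<close>

lemma weighted_laplacian_gaussian:
  fixes f \<nu> :: "real ^ 'n \<Rightarrow> 'e::euclidean_space"
  assumes f: "Ck_on 2 S f" and \<nu>: "\<nu> differentiable (at y)" and S: "open S" "y \<in> S"
    and inj: "inj (frechet_derivative f (at y))" and dim: "DIM('e) = CARD('n) + 1"
    and unit: "norm (\<nu> y) = 1"
    and normal: "\<And>x v. x \<in> S \<Longrightarrow> \<nu> x \<bullet> frechet_derivative f (at x) v = 0"
    and H: "mean_curvature f \<nu> y = - (1 / 2) * (f y \<bullet> \<nu> y)"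
  defines "u \<equiv> \<lambda>x. exp (- expander_weight (f x))"
  shows "laplace_beltrami (induced_metric f) u y + grad_inner (induced_metric f) (expander_weight \<circ> f) u y =
    - u y * (CARD('n) / 2 + (f y \<bullet> \<nu> y)\<^sup>2 / 4)"
proof -
  define g where "g = induced_metric f y"
  define G where "G = matrix_inv g"
  define e where "e i = partial i f y" for i
  define a where "a i j = partial i (partial j f) y" for i j
  define h where "h i j = second_fundamental_form f \<nu> y $ i $ j" for i j
  define p where "p i = f y \<bullet> e i" for i
  \<comment> \<open>For an induced metric the Christoffel symbols have this shorter form, verified
    below. With it, \<open>w i j\<close> is the covariant Hessian of the position vector.\<close>
  define \<Gamma> where "\<Gamma> k i j = (\<Sum>l\<in>UNIV. G $ k $ l * (a i j \<bullet> e l))" for k i j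
  define w where "w i j = a i j - (\<Sum>k\<in>UNIV. \<Gamma> k i j *\<^sub>R e k)" for i j

  have lin: "linear (frechet_derivative f (at y))"
    using Ck_on_2_D(1)[OF f S(2)] by (rule has_derivative_linear)
  have g: "g $ i $ j = e i \<bullet> e j" for i j
    by (simp add: g_def induced_metric_def e_def)
  have "invertible g"
    unfolding g_def by (rule invertible_induced_metric[OF lin inj])
  then have gG: "(\<Sum>k\<in>UNIV. (e i \<bullet> e k) * G $ k $ j) = (if i = j then 1 else 0)" for i j
    using arg_cong[OF matrix_inv_works(1), of g "\<lambda>A. A $ i $ j"]
    by (simp add: G_def g matrix_matrix_mult_def mat_def)
  have a_sym: "a i j = a j i" for i j
    unfolding a_def by (rule partial_symmetric[OF f S])
  have \<Gamma>: "christoffel (induced_metric f) k i j y = \<Gamma> k i j" for k i j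
  proof -
    \<comment> \<open>By symmetry of \<open>a\<close>, four of the six terms cancel in pairs and the
      other two coincide; the resulting factor 2 cancels the division by 2 in
      \<open>christoffel\<close>.\<close>
    have *: "a i j \<bullet> e l + e j \<bullet> a i l + (a j i \<bullet> e l + e i \<bullet> a j l) - (a l i \<bullet> e j + e i \<bullet> a l j) =
        2 * (a i j \<bullet> e l)" for l
      by (simp add: a_sym[of j i] a_sym[of l i] a_sym[of l j] inner_commute)
    show ?thesis
      unfolding christoffel_def \<Gamma>_def partial_induced_metric[OF f S] a_def[symmetric] e_def[symmetric] *
      by (simp add: G_def g_def sum_divide_distrib)
  qed

  \<comment> \<open>Since \<open>G\<close> inverts the Gram matrix of the \<open>e k\<close>, the
    \<Gamma>-combination is exactly the tangential part of \<open>a i j\<close>.\<close>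
  have w_tangent: "w i j \<bullet> e m = 0" for i j m
  proof -
    have "(\<Sum>k\<in>UNIV. \<Gamma> k i j *\<^sub>R e k) \<bullet> e m =
        (\<Sum>k\<in>UNIV. \<Sum>l\<in>UNIV. (e m \<bullet> e k) * G $ k $ l * (a i j \<bullet> e l))"
      by (simp add: inner_sum_left \<Gamma>_def sum_distrib_left sum_distrib_right inner_commute[of "e m"] mult_ac)
    also have "\<dots> = (\<Sum>l\<in>UNIV. (\<Sum>k\<in>UNIV. (e m \<bullet> e k) * G $ k $ l) * (a i j \<bullet> e l))"
      by (subst sum.swap) (simp add: sum_distrib_right)
    also have "\<dots> = a i j \<bullet> e m"
      by (simp add: gG if_distrib[of "\<lambda>c. c * _"] cong: if_cong)
    finally show ?thesis
      by (simp add: w_def inner_diff_left)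
  qed
  have \<nu>e: "\<nu> y \<bullet> e m = 0" for m
    using normal[OF S(2)] by (simp add: e_def partial_def)
  have \<nu>a: "\<nu> y \<bullet> a i j = - h i j" for i j
  proof -
    \<comment> \<open>The inner product of the normal with a partial derivative vanishes on all of
      \<open>S\<close>, so its derivative at \<open>y\<close> is zero; the product rule turns this
      into the relation between \<open>a\<close> and \<open>h\<close>.\<close>
    have "((\<lambda>x. \<nu> x \<bullet> partial j f x) has_derivative
        (\<lambda>v. \<nu> y \<bullet> frechet_derivative (partial j f) (at y) v
           + frechet_derivative \<nu> (at y) v \<bullet> partial j f y)) (at y)"
      using \<nu> Ck_on_2_D(2)[OF f S(2)]
      by (intro has_derivative_inner) (simp_all add: partial_def[abs_def] frechet_derivative_works)
    moreover have "((\<lambda>x. \<nu> x \<bullet> partial j f x) has_derivative (\<lambda>v. 0)) (at y)"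
      by (rule has_derivative_transform_within_open[OF has_derivative_const S])
         (simp add: partial_def normal)
    ultimately have "(\<lambda>v. \<nu> y \<bullet> frechet_derivative (partial j f) (at y) v
           + frechet_derivative \<nu> (at y) v \<bullet> partial j f y) = (\<lambda>v. 0)"
      by (rule has_derivative_unique)
    then have "\<nu> y \<bullet> a i j + partial i \<nu> y \<bullet> e j = 0"
      unfolding a_def e_def partial_def[of i] by metis
    then show ?thesis
      by (simp add: h_def second_fundamental_form_def e_def)
  qed
  \<comment> \<open>Gauss formula: \<open>w i j\<close> has no tangential part, so it is determined
    by its component along \<open>\<nu> y\<close>. The minus sign comes from the convention that the
    second fundamental form differentiates the normal.\<close>
  have fw: "f y \<bullet> w i j = - h i j * (f y \<bullet> \<nu> y)" for i j
  proof -
    have "\<nu> y \<bullet> w i j = - h i j"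
      by (simp add: w_def inner_diff_right inner_sum_right \<nu>a \<nu>e)
    then have "w i j \<bullet> \<nu> y = - h i j"
      by (simp only: inner_commute)
    moreover have "w i j = (w i j \<bullet> \<nu> y) *\<^sub>R \<nu> y"
      by (rule normal_component[OF lin inj dim unit normal[OF S(2)]])
         (use w_tangent in \<open>simp add: e_def partial_def\<close>)
    ultimately have "w i j = - h i j *\<^sub>R \<nu> y" by simp
    then show ?thesis by simp
  qed

  have u1: "partial i u y = - (u y * p i) / 2" for i
    unfolding partial_def u_def
    by (subst frechet_derivative_gaussian[OF f S]) (simp add: p_def e_def partial_def)
  have u2: "partial i (partial j u) y =
      u y * (p i * p j / 4 - (e i \<bullet> e j + f y \<bullet> a i j) / 2)" for i j
    using frechet_derivative_gaussian2[OF f S, of "axis j 1" "axis i 1"]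
    by (simp add: partial_def[abs_def] u_def p_def e_def a_def mult_ac)
  \<comment> \<open>As \<open>partial k u y\<close> is a multiple of \<open>p k\<close>, the
    Christoffel terms turn \<open>f y \<bullet> a i j\<close> into
    \<open>f y \<bullet> w i j\<close>.\<close>
  have "partial i (partial j u) y - (\<Sum>k\<in>UNIV. \<Gamma> k i j * partial k u y) =
      u y * (p i * p j / 4 - (e i \<bullet> e j) / 2 - (f y \<bullet> w i j) / 2)" for i j
    by (simp add: u1 u2 w_def inner_diff_right inner_sum_right p_def[symmetric] sum_distrib_left
        sum_negf sum_divide_distrib[symmetric] mult_ac algebra_simps diff_divide_distrib add_divide_distrib)
  then have "laplace_beltrami (induced_metric f) u y = (\<Sum>i\<in>UNIV. \<Sum>j\<in>UNIV. G $ i $ j *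
      (u y * (p i * p j / 4 - (e i \<bullet> e j) / 2 + h i j * (f y \<bullet> \<nu> y) / 2)))"
    by (simp add: laplace_beltrami_def \<Gamma> G_def[symmetric] g_def[symmetric] fw)
  moreover have "grad_inner (induced_metric f) (expander_weight \<circ> f) u y =
      (\<Sum>i\<in>UNIV. \<Sum>j\<in>UNIV. G $ i $ j * (u y * (- p i * p j / 4)))"
    by (simp add: grad_inner_def G_def[symmetric] g_def[symmetric] u1 partial_expander_weight[OF f S]
        e_def[symmetric] p_def[symmetric] mult_ac)
  \<comment> \<open>The products \<open>p i * p j\<close> from the Hessian of \<open>u\<close> and
    from the drift cancel term by term.\<close>
  moreover have termwise: "G $ i $ j * (u y * (p i * p j / 4 - (e i \<bullet> e j) / 2 + h i j * (f y \<bullet> \<nu> y) / 2))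
      + G $ i $ j * (u y * (- p i * p j / 4)) =
      u y / 2 * ((f y \<bullet> \<nu> y) * (G $ i $ j * h i j) - (e j \<bullet> e i) * G $ i $ j)" for i j
    unfolding inner_commute[of "e j" "e i"] by (simp add: field_simps)
  ultimately have "laplace_beltrami (induced_metric f) u y
        + grad_inner (induced_metric f) (expander_weight \<circ> f) u y =
      (\<Sum>i\<in>UNIV. \<Sum>j\<in>UNIV. u y / 2 * ((f y \<bullet> \<nu> y) * (G $ i $ j * h i j) - (e j \<bullet> e i) * G $ i $ j))"
    by (simp only: sum.distrib[symmetric] termwise)
  also have "\<dots> = u y / 2 * ((f y \<bullet> \<nu> y) * (\<Sum>i\<in>UNIV. \<Sum>j\<in>UNIV. G $ i $ j * h i j)
      - (\<Sum>i\<in>UNIV. \<Sum>j\<in>UNIV. (e j \<bullet> e i) * G $ i $ j))"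
    by (simp only: sum_subtractf sum_distrib_left[symmetric])
  \<comment> \<open>After the swap each inner sum is a diagonal entry of the identity matrix in
    \<open>gG\<close>.\<close>
  also have "(\<Sum>i\<in>UNIV. \<Sum>j\<in>UNIV. (e j \<bullet> e i) * G $ i $ j) = CARD('n)"
    by (subst sum.swap) (simp add: gG)
  \<comment> \<open>This double sum is the mean curvature, so the self-expander equation enters
    here.\<close>
  also have "(\<Sum>i\<in>UNIV. \<Sum>j\<in>UNIV. G $ i $ j * h i j) = - (1 / 2) * (f y \<bullet> \<nu> y)"
    using H by (simp add: mean_curvature_def G_def g_def h_def)
  also have "u y / 2 * ((f y \<bullet> \<nu> y) * (- (1 / 2) * (f y \<bullet> \<nu> y)) - CARD('n)) =
      - u y * (CARD('n) / 2 + (f y \<bullet> \<nu> y)\<^sup>2 / 4)"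
    by (simp add: power2_eq_square field_simps)
  finally show ?thesis .
qed

text \<open>Partial derivatives read a neighbourhood, so constancy on an open set kills those of
  first and second order. This is set against the strict negativity for the Gaussian.\<close>

lemma weighted_laplacian_const:
  fixes u :: "real ^ 'n \<Rightarrow> real"
  assumes S: "open S" "y \<in> S" and c: "\<And>x. x \<in> S \<Longrightarrow> u x = c"
  shows "laplace_beltrami g u y + grad_inner g v u y = 0"
proof -
  have 1: "partial i u x = 0" if "x \<in> S" for i x
  proof -
    have "(u has_derivative (\<lambda>v. 0)) (at x)"
      by (rule has_derivative_transform_within_open[OF has_derivative_const S(1) that]) (simp add: c)
    from partial_eqI[OF this] show ?thesis .
  qed
  have 2: "partial i (partial j u) y = 0" for i j
  proof -
    have "(partial j u has_derivative (\<lambda>v. 0)) (at y)"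
      by (rule has_derivative_transform_within_open[OF has_derivative_const S]) (simp add: 1)
    from partial_eqI[OF this] show ?thesis .
  qed
  show ?thesis
    using S by (simp add: laplace_beltrami_def grad_inner_def 1 2)
qed

section \<open>Failure of weighted parabolicity\<close>

lemma smooth_on_imp_Ck_on: "smooth_on S f \<Longrightarrow> Ck_on k S f"
  by (simp add: smooth_on_def)

theorem self_expander_not_weighted_parabolic:
  fixes X :: "'p topology" and \<A> :: "('n::finite, 'p) parametrization set"
    and F N :: "'p \<Rightarrow> real ^ 'k"
  assumes expander: "self_expander X \<A> F N"
  shows "\<not> weighted_parabolic X \<A> F"
proof
  assume parabolic: "weighted_parabolic X \<A> F"
  have hyp: "oriented_hypersurface X \<A> F N"
    using expander by (simp add: self_expander_def)
  then have atlas: "smooth_atlas X \<A>" and dim: "CARD('k) = CARD('n) + 1"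
    unfolding oriented_hypersurface_def smooth_manifold_def by blast+
  have dim': "DIM(real ^ 'k) = CARD('n) + 1"
    by (simp add: dim)
  have W: "open W" if "(W, \<phi>) \<in> \<A>" for W \<phi>
    using atlas that unfolding smooth_atlas_def by blast
  have C2: "Ck_on 2 W (F \<circ> \<phi>)" if "(W, \<phi>) \<in> \<A>" for W \<phi>
    using hyp that unfolding oriented_hypersurface_def smooth_fun_def by (blast intro: smooth_on_imp_Ck_on)
  have N: "smooth_on W (N \<circ> \<phi>)" if "(W, \<phi>) \<in> \<A>" for W \<phi>
    using hyp that unfolding oriented_hypersurface_def smooth_fun_def by blast
  define u :: "'p \<Rightarrow> real" where "u q = exp (- expander_weight (F q))" for q
  have u: "u \<circ> \<phi> = (\<lambda>x. exp (- expander_weight ((F \<circ> \<phi>) x)))" for \<phi> :: "real ^ 'n \<Rightarrow> 'p"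
    by (simp add: u_def fun_eq_iff)
  have neg: "laplace_beltrami (induced_metric (F \<circ> \<phi>)) (u \<circ> \<phi>) y
      + grad_inner (induced_metric (F \<circ> \<phi>)) (expander_weight \<circ> F \<circ> \<phi>) (u \<circ> \<phi>) y < 0"
    if A: "(W, \<phi>) \<in> \<A>" and y: "y \<in> W" for W \<phi> y
  proof -
    have imm: "\<forall>y\<in>W. inj (frechet_derivative (F \<circ> \<phi>) (at y)) \<and> norm (N (\<phi> y)) = 1 \<and>
        (\<forall>v. N (\<phi> y) \<bullet> frechet_derivative (F \<circ> \<phi>) (at y) v = 0)"
      using hyp A unfolding oriented_hypersurface_def by blast
    have inj: "inj (frechet_derivative (F \<circ> \<phi>) (at y))"
      and unit: "norm ((N \<circ> \<phi>) y) = 1"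
      and normal: "(N \<circ> \<phi>) x \<bullet> frechet_derivative (F \<circ> \<phi>) (at x) v = 0" if "x \<in> W" for x v
      using imm y that by simp_all
    have diff: "(N \<circ> \<phi>) differentiable (at y)"
      using smooth_on_imp_Ck_on[of W "N \<circ> \<phi>" "Suc 0"] N[OF A] y by simp
    have H: "mean_curvature (F \<circ> \<phi>) (N \<circ> \<phi>) y = - (1 / 2) * ((F \<circ> \<phi>) y \<bullet> (N \<circ> \<phi>) y)"
      using expander A y unfolding self_expander_def comp_def by blast
    have "laplace_beltrami (induced_metric (F \<circ> \<phi>)) (u \<circ> \<phi>) y
        + grad_inner (induced_metric (F \<circ> \<phi>)) (expander_weight \<circ> (F \<circ> \<phi>)) (u \<circ> \<phi>) y =
        - u (\<phi> y) * (CARD('n) / 2 + (F (\<phi> y) \<bullet> N (\<phi> y))\<^sup>2 / 4)"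
      using weighted_laplacian_gaussian[OF C2[OF A] diff W[OF A] y inj[OF y] dim' unit[OF y] normal H]
      unfolding u by (simp only: u_def comp_apply)
    \<comment> \<open>Strictness holds even where the position vector is tangential, because the
      index type has at least one element and the exponential is positive.\<close>
    moreover have "0 < u (\<phi> y) * (CARD('n) / 2 + (F (\<phi> y) \<bullet> N (\<phi> y))\<^sup>2 / 4)"
      by (simp add: u_def add_pos_nonneg)
    ultimately show ?thesis
      by (simp add: comp_assoc)
  qed
  have "Ck_fun 2 \<A> u"
    unfolding Ck_fun_def u using Ck_on_2_gaussian[OF C2 W] by blast
  moreover have "\<forall>p\<in>topspace X. 0 \<le> u p"
    by (simp add: u_def)
  moreover have "\<forall>(W, \<phi>)\<in>\<A>. \<forall>y\<in>W.
           laplace_beltrami (induced_metric (F \<circ> \<phi>)) (u \<circ> \<phi>) y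
           + grad_inner (induced_metric (F \<circ> \<phi>)) (expander_weight \<circ> F \<circ> \<phi>) (u \<circ> \<phi>) y \<le> 0"
    using neg by (blast intro: less_imp_le)
  ultimately have "u constant_on topspace X"
    using parabolic unfolding weighted_parabolic_def by blast
  then obtain c where c: "\<And>q. q \<in> topspace X \<Longrightarrow> u q = c"
    by (auto simp: constant_on_def)
  have top: "topspace X = (\<Union>(W, \<phi>)\<in>\<A>. \<phi> ` W)"
    using atlas unfolding smooth_atlas_def by blast
  \<comment> \<open>Nonemptiness yields a coordinate point at which the strict inequality can be
    evaluated.\<close>
  moreover have "topspace X \<noteq> {}"
    using hyp unfolding oriented_hypersurface_def by blast
  ultimately obtain W \<phi> y where A: "(W, \<phi>) \<in> \<A>" and y: "y \<in> W"
    by blast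
  have "(u \<circ> \<phi>) x = c" if "x \<in> W" for x
  proof -
    have "\<phi> x \<in> topspace X"
      unfolding top using A that by blast
    then show ?thesis by (simp add: c)
  qed
  \<comment> \<open>At \<open>y\<close> the same expression is zero, since \<open>u\<close> is
    constant on the patch, and negative by \<open>neg\<close>.\<close>
  from weighted_laplacian_const[where u = "u \<circ> \<phi>" and c = c, OF W[OF A] y this] neg[OF A y]
  show False
    by (metis less_irrefl)
qed

theorem proposition5p1:
  assumes "CARD('k::finite) = CARD('n::finite) + 1"
  shows "\<not> (\<exists>(X :: 'p topology) (\<A> :: ('n, 'p) parametrization set)
              (F :: 'p \<Rightarrow> real ^ 'k) (N :: 'p \<Rightarrow> real ^ 'k).
            self_expander X \<A> F N \<and>
            complete_hypersurface X \<A> F \<and>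
            weighted_parabolic X \<A> F \<and>
            L_stable X \<A> F \<and>
            (\<forall>(W, \<phi>)\<in>\<A>. \<forall>y\<in>W. norm_sq_A (F \<circ> \<phi>) (N \<circ> \<phi>) y \<ge> 1 / 2))"
  using self_expander_not_weighted_parabolic by blast

end
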